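(* Let $d=1$, let $(\Omega,\mathcal{F},\mathbb{P})$ be a probability space with an invertible ergodic measure-preserving transformation $T$, and let $p^+,p^-:\Omega\to[0,1]$ be measurable with $p^++p^-=1$. Suppose $\int|\log p^{\pm}(\omega)|\,d\mathbb{P}<\infty$. Then for every $\lambda\in\mathbb{R}$, for $\mathbb{P}$-almost every $\omega$, $$\lim_{n\to\infty}\frac1n\log E^{P_\omega}\left[\mathrm{e}^{\lambda X_n}\right]=\Lambda(\lambda).$$
   Context: $P_\omega$ is the law of the random walk $(X_n)$ on $\mathbb{Z}$ with $X_0=0$ which, from $x$, steps to $x+1$ with probability $p^+(T^x\omega)$ and to $x-1$ with probability $p^-(T^x\omega)$. The class $\mathcal{K}$ consists of pairs of functions $F^\pm\in L^1(\mathbb{P})$ with $\mathbb{E}[F^\pm]=0$ and $F^+(\omega)+F^-(T\omega)=0$. Define $$\Lambda(\lambda)=\inf_{F\in\mathcal{K}}\operatorname*{ess\,sup}_\omega\log\left\{p^+(\omega)\mathrm{e}^{\lambda+F^+(\omega)}+p^-(\omega)\mathrm{e}^{-\lambda+F^-(\omega)}\right\},$$ the essential supremum with respect to $\mathbb{P}$. *)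

theory Defs
  imports "HOL-Probability.Probability"
begin

definition invertible_mpt :: "'a measure \<Rightarrow> ('a \<Rightarrow> 'a) \<Rightarrow> bool" where
  "invertible_mpt M T \<longleftrightarrow>
     T \<in> M \<rightarrow>\<^sub>M M \<and> bij_betw T (space M) (space M) \<and>
     inv_into (space M) T \<in> M \<rightarrow>\<^sub>M M \<and>
     (\<forall>A \<in> sets M. emeasure M (T -` A \<inter> space M) = emeasure M A)"

definition ergodic :: "'a measure \<Rightarrow> ('a \<Rightarrow> 'a) \<Rightarrow> bool" where
  "ergodic M T \<longleftrightarrow>
     (\<forall>A \<in> sets M. T -` A \<inter> space M = A \<longrightarrow> measure M A = 0 \<or> measure M A = 1)"

definition Tpow :: "'a measure \<Rightarrow> ('a \<Rightarrow> 'a) \<Rightarrow> int \<Rightarrow> 'a \<Rightarrow> 'a" where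
  "Tpow M T x = (if 0 \<le> x then T ^^ nat x else inv_into (space M) T ^^ nat (- x))"

text \<open>Law of X_n under the quenched measure P_omega (walk started at 0):
  from x it steps to x+1 with probability p^+(T^x omega) and to x-1 otherwise
  (i.e. with probability p^-(T^x omega) = 1 - p^+(T^x omega)).\<close>
fun walk_law :: "'a measure \<Rightarrow> ('a \<Rightarrow> 'a) \<Rightarrow> ('a \<Rightarrow> real) \<Rightarrow> 'a \<Rightarrow> nat \<Rightarrow> int pmf" where
  "walk_law M T pp \<omega> 0 = return_pmf 0"
| "walk_law M T pp \<omega> (Suc n) =
     bind_pmf (walk_law M T pp \<omega> n)
       (\<lambda>x. map_pmf (\<lambda>b. if b then x + 1 else x - 1) (bernoulli_pmf (pp (Tpow M T x \<omega>))))"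

definition quenched_mgf :: "'a measure \<Rightarrow> ('a \<Rightarrow> 'a) \<Rightarrow> ('a \<Rightarrow> real) \<Rightarrow> 'a \<Rightarrow> real \<Rightarrow> nat \<Rightarrow> real" where
  "quenched_mgf M T pp \<omega> lam n =
     measure_pmf.expectation (walk_law M T pp \<omega> n) (\<lambda>x. exp (lam * real_of_int x))"

definition classK :: "'a measure \<Rightarrow> ('a \<Rightarrow> 'a) \<Rightarrow> (('a \<Rightarrow> real) \<times> ('a \<Rightarrow> real)) set" where
  "classK M T = {(Fp, Fm). integrable M Fp \<and> integrable M Fm \<and>
      integral\<^sup>L M Fp = 0 \<and> integral\<^sup>L M Fm = 0 \<and>
      (AE \<omega> in M. Fp \<omega> + Fm (T \<omega>) = 0)}"

definition Lambda :: "'a measure \<Rightarrow> ('a \<Rightarrow> 'a) \<Rightarrow> ('a \<Rightarrow> real) \<Rightarrow> ('a \<Rightarrow> real) \<Rightarrow> real \<Rightarrow> ereal" where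
  "Lambda M T pp pm lam =
     (INF F \<in> classK M T. esssup M (\<lambda>\<omega>. ereal (ln (pp \<omega> * exp (lam + fst F \<omega>)
                                              + pm \<omega> * exp (- lam + snd F \<omega>)))))"

end

theory Submission
  imports Defs
begin

text \<open>
  Write \<open>S = T\<^sup>-\<^sup>1\<close>, \<open>a = p\<^sup>+ e\<^sup>\<lambda>\<close>, \<open>b = p\<^sup>- e\<^sup>-\<^sup>\<lambda>\<close>; then \<open>Z\<^sub>n(\<omega>) = E[e\<^bsup>\<lambda>X\<^sub>n\<^esup>]\<close> satisfies
  \<open>Z\<^sub>n\<^sub>+\<^sub>1 = a Z\<^sub>n \<circ> T + b Z\<^sub>n \<circ> S\<close>. An element \<open>F\<close> of the class \<open>\<K>\<close> with
  \<open>a exp F\<^sup>+ + b exp F\<^sup>- \<le> e\<^sup>c\<close> turns \<open>e\<^sup>c\<^sup>n\<close> times the exponential of a sublinear potential into a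
  supersolution, so \<open>Z\<^sub>n\<close> grows at rate at most \<open>c\<close>.

  Conversely let \<open>c < \<Lambda>(\<lambda>)\<close>. If \<open>e\<^sup>-\<^sup>c\<^sup>n Z\<^sub>n\<close> were summable, the coboundary of the logarithm of its sum
  would be an element of \<open>\<K>\<close> showing \<open>\<Lambda>(\<lambda>) \<le> c\<close>. Hence for slightly smaller \<open>c\<close> the weights
  \<open>e\<^sup>-\<^sup>c\<^sup>n W\<^sub>n(x)\<close> of the paths ending in \<open>x\<close> are unbounded, over \<open>x \<ge> 0\<close> say, and by ergodicity this holds
  from almost every starting environment. Concatenating such path segments, which all go to the
  right, bounds \<open>Z\<^sub>n\<close> from below for every \<open>n\<close>. The case \<open>x \<le> 0\<close> follows by exchanging
  \<open>(T, a)\<close> and \<open>(S, b)\<close>.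
\<close>

subsection \<open>Ergodic automorphisms\<close>

text \<open>The inverse is an explicit parameter \<open>S\<close>, so that reversing the direction
  is an interpretation with \<open>T\<close> and \<open>S\<close> exchanged.\<close>

locale ergodic_automorphism = prob_space M for M :: "'a measure" +
  fixes T S :: "'a \<Rightarrow> 'a"
  assumes T_measurable [measurable]: "T \<in> M \<rightarrow>\<^sub>M M"
    and S_measurable [measurable]: "S \<in> M \<rightarrow>\<^sub>M M"
    and TS: "\<And>\<omega>. \<omega> \<in> space M \<Longrightarrow> T (S \<omega>) = \<omega>"
    and ST: "\<And>\<omega>. \<omega> \<in> space M \<Longrightarrow> S (T \<omega>) = \<omega>"
    and preserving: "\<And>A. A \<in> sets M \<Longrightarrow> emeasure M (T -` A \<inter> space M) = emeasure M A"
    and ergodic: "ergodic M T"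
begin

lemma T_space [simp]: "\<omega> \<in> space M \<Longrightarrow> T \<omega> \<in> space M"
  using measurable_space[OF T_measurable] .

lemma S_space [simp]: "\<omega> \<in> space M \<Longrightarrow> S \<omega> \<in> space M"
  using measurable_space[OF S_measurable] .

lemma inverse_automorphism: "ergodic_automorphism M S T"
proof unfold_locales
  fix A assume A: "A \<in> sets M"
  have "T -` (S -` A \<inter> space M) \<inter> space M = A"
    using sets.sets_into_space[OF A] by (auto simp: ST)
  then show "emeasure M (S -` A \<inter> space M) = emeasure M A"
    using preserving[of "S -` A \<inter> space M"] A by simp
next
  have "T -` A \<inter> space M = A" if "A \<in> sets M" "S -` A \<inter> space M = A" for A
    using that sets.sets_into_space[OF that(1)]
    by (auto simp: set_eq_iff) (metis ST T_space)+
  then show "ergodic M S"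
    using ergodic by (simp add: ergodic_def)
qed (auto simp: TS ST)

lemma distr_T: "distr M M T = M"
  by (rule measure_eqI) (auto simp: emeasure_distr preserving)

lemma AE_T: "AE \<omega> in M. P \<omega> \<Longrightarrow> AE \<omega> in M. P (T \<omega>)"
  using AE_distrD[OF T_measurable, of P] unfolding distr_T .

lemma integrable_T: "integrable M f \<Longrightarrow> integrable M (\<lambda>\<omega>. f (T \<omega>))"
  for f :: "'a \<Rightarrow> real"
  using integrable_distr[OF T_measurable, of f] by (simp add: distr_T)

lemma integral_T: "f \<in> borel_measurable M \<Longrightarrow> (\<integral>\<omega>. f (T \<omega>) \<partial>M) = (\<integral>\<omega>. f \<omega> \<partial>M)"
  for f :: "'a \<Rightarrow> real"
  using integral_distr[OF T_measurable, of f] by (simp add: distr_T)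

text \<open>Removing every point whose orbit, in either direction, meets the exceptional null set
  costs only countably many null sets. On what remains, almost sure relations can be iterated along
  orbits.\<close>

lemma invariant_full_set:
  assumes "AE \<omega> in M. P \<omega>"
  obtains G where "G \<in> sets M" "AE \<omega> in M. \<omega> \<in> G"
    "\<And>\<omega>. \<omega> \<in> G \<Longrightarrow> \<omega> \<in> space M \<and> P \<omega> \<and> T \<omega> \<in> G \<and> S \<omega> \<in> G"
proof -
  interpret inv: ergodic_automorphism M S T by (rule inverse_automorphism)
  from assms obtain N where N: "{\<omega> \<in> space M. \<not> P \<omega>} \<subseteq> N" "N \<in> sets M" "emeasure M N = 0"
    by (auto elim!: AE_E)
  have Tn [measurable]: "T ^^ k \<in> M \<rightarrow>\<^sub>M M" and Sn [measurable]: "S ^^ k \<in> M \<rightarrow>\<^sub>M M" for k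
    by (simp_all add: measurable_compose_n)
  define G where "G = {\<omega> \<in> space M. \<forall>k. (T ^^ k) \<omega> \<notin> N \<and> (S ^^ k) \<omega> \<notin> N}"
  have AE_N: "AE \<omega> in M. \<omega> \<notin> N"
    using N by (intro AE_not_in) (auto simp: null_sets_def)
  have "AE \<omega> in M. (T ^^ k) \<omega> \<notin> N" for k
  proof (induction k)
    case (Suc k)
    from AE_T[OF Suc] show ?case by (simp add: funpow_Suc_right del: funpow.simps(2))
  qed (use AE_N in simp)
  moreover have "AE \<omega> in M. (S ^^ k) \<omega> \<notin> N" for k
  proof (induction k)
    case (Suc k)
    from inv.AE_T[OF Suc] show ?case by (simp add: funpow_Suc_right del: funpow.simps(2))
  qed (use AE_N in simp)
  ultimately have AE_G: "AE \<omega> in M. \<omega> \<in> G"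
    by (auto simp: G_def AE_all_countable)
  have shift: "(S ^^ k) (T \<omega>) \<notin> N \<and> (T ^^ k) (S \<omega>) \<notin> N" if "\<omega> \<in> G" for \<omega> k
  proof (cases k)
    case 0
    have "(T ^^ 1) \<omega> \<notin> N" "(S ^^ 1) \<omega> \<notin> N"
      using that unfolding G_def by blast+
    then show ?thesis using 0 by simp
  next
    case (Suc j)
    then show ?thesis
      using that by (auto simp: G_def funpow_Suc_right TS ST simp del: funpow.simps(2))
  qed
  have shift': "(T ^^ k) (T \<omega>) \<notin> N \<and> (S ^^ k) (S \<omega>) \<notin> N" if "\<omega> \<in> G" for \<omega> k
  proof -
    have "(T ^^ Suc k) \<omega> \<notin> N" "(S ^^ Suc k) \<omega> \<notin> N"
      using that unfolding G_def by blast+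
    then show ?thesis by (simp add: funpow_Suc_right del: funpow.simps(2))
  qed
  show ?thesis
  proof (rule that[OF _ AE_G])
    show "G \<in> sets M"
      unfolding G_def using N(2) by measurable
    fix \<omega> assume \<omega>: "\<omega> \<in> G"
    then have "\<omega> \<in> space M" "(T ^^ 0) \<omega> \<notin> N"
      unfolding G_def by blast+
    then show "\<omega> \<in> space M \<and> P \<omega> \<and> T \<omega> \<in> G \<and> S \<omega> \<in> G"
      using N(1) shift[OF \<omega>] shift'[OF \<omega>] by (auto simp: G_def)
  qed
qed

text \<open>By \<open>imp\<close>, \<open>A\<close> lies in its preimage up to a null set; both have
  the same measure, so they agree almost surely. Cutting with an invariant full set makes the
  invariance exact, as \<open>ergodic\<close> demands.\<close>

lemma zero_one:
  assumes A [measurable]: "A \<in> sets M" and imp: "AE \<omega> in M. \<omega> \<in> A \<longrightarrow> T \<omega> \<in> A"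
  shows "(AE \<omega> in M. \<omega> \<in> A) \<or> (AE \<omega> in M. \<omega> \<notin> A)"
proof -
  define B where "B = T -` A \<inter> space M"
  have [measurable]: "B \<in> sets M" unfolding B_def by measurable
  have "AE \<omega> in M. \<omega> \<notin> A - B"
    using imp AE_space by eventually_elim (auto simp: B_def)
  then have "prob (A - B) = 0"
    by (subst (asm) prob_eq_0[symmetric]) auto
  moreover have "prob B = prob A"
    using preserving[OF A] by (simp add: B_def measure_def)
  ultimately have "prob (B - A) = 0"
    using finite_measure_Diff'[of A B] finite_measure_Diff'[of B A] by (simp add: Int_commute)
  then have "AE \<omega> in M. \<omega> \<notin> B - A"
    by (subst prob_eq_0[symmetric]) auto
  with imp AE_space have "AE \<omega> in M. \<omega> \<in> A \<longleftrightarrow> T \<omega> \<in> A"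
    by eventually_elim (auto simp: B_def)
  then obtain G where G: "G \<in> sets M" "AE \<omega> in M. \<omega> \<in> G"
    "\<And>\<omega>. \<omega> \<in> G \<Longrightarrow> \<omega> \<in> space M \<and> (\<omega> \<in> A \<longleftrightarrow> T \<omega> \<in> A) \<and> T \<omega> \<in> G \<and> S \<omega> \<in> G"
    by (rule invariant_full_set) blast
  have "T -` (A \<inter> G) \<inter> space M = A \<inter> G"
    using G(3) ST by (auto; metis)
  moreover have "A \<inter> G \<in> sets M" using G(1) by simp
  ultimately have "prob (A \<inter> G) = 0 \<or> prob (A \<inter> G) = 1"
    using ergodic by (auto simp: ergodic_def)
  then have "(AE \<omega> in M. \<omega> \<in> A \<inter> G) \<or> (AE \<omega> in M. \<omega> \<notin> A \<inter> G)"
    using \<open>A \<inter> G \<in> sets M\<close> by (metis prob_eq_0 prob_eq_1)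
  then show ?thesis
  proof
    assume "AE \<omega> in M. \<omega> \<in> A \<inter> G"
    then have "AE \<omega> in M. \<omega> \<in> A" by eventually_elim simp
    then show ?thesis ..
  next
    assume "AE \<omega> in M. \<omega> \<notin> A \<inter> G"
    with G(2) have "AE \<omega> in M. \<omega> \<notin> A" by eventually_elim simp
    then show ?thesis ..
  qed
qed

section \<open>Coboundaries and Birkhoff sums\<close>

text \<open>\<open>V\<close> need not be integrable, so its two integrals cannot simply be
  subtracted. Truncation at level \<open>k\<close> is 1-Lipschitz: the truncated increments stay
  dominated by those of \<open>V\<close>, and their integrals cancel.\<close>

lemma coboundary_integral_eq_0:
  fixes V :: "'a \<Rightarrow> real"
  assumes [measurable]: "V \<in> borel_measurable M"
    and int: "integrable M (\<lambda>\<omega>. V (T \<omega>) - V \<omega>)"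
  shows "(\<integral>\<omega>. V (T \<omega>) - V \<omega> \<partial>M) = 0"
proof -
  define c where "c k x = max (- real k) (min (real k) x)" for k :: nat and x :: real
  have [measurable]: "c k \<in> borel_measurable borel" for k unfolding c_def by measurable
  have int_c: "integrable M (\<lambda>\<omega>. c k (V \<omega>))" for k
    by (rule integrable_const_bound[where B = "real k"]) (auto simp: c_def)
  have zero: "(\<integral>\<omega>. c k (V (T \<omega>)) - c k (V \<omega>) \<partial>M) = 0" for k
    using integral_T[of "\<lambda>\<omega>. c k (V \<omega>)"] integrable_T[OF int_c[of k]] int_c[of k] by simp
  have ev: "\<forall>\<^sub>F k in sequentially. c k x = x" for x
  proof -
    have "\<forall>\<^sub>F k in sequentially. \<bar>x\<bar> \<le> real k"
      using filterlim_real_sequentially by (simp add: filterlim_at_top)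
    then show ?thesis by eventually_elim (auto simp: c_def)
  qed
  have "(\<lambda>k. \<integral>\<omega>. c k (V (T \<omega>)) - c k (V \<omega>) \<partial>M) \<longlonglongrightarrow> (\<integral>\<omega>. V (T \<omega>) - V \<omega> \<partial>M)"
  proof (rule integral_dominated_convergence[where w = "\<lambda>\<omega>. \<bar>V (T \<omega>) - V \<omega>\<bar>"])
    show "AE \<omega> in M. (\<lambda>k. c k (V (T \<omega>)) - c k (V \<omega>)) \<longlonglongrightarrow> V (T \<omega>) - V \<omega>"
      by (intro AE_I2 tendsto_diff tendsto_eventually ev)
    show "AE \<omega> in M. norm (c k (V (T \<omega>)) - c k (V \<omega>)) \<le> \<bar>V (T \<omega>) - V \<omega>\<bar>" for k
      by (auto simp: c_def)
  qed (use int in auto)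
  then show ?thesis
    by (simp add: zero LIMSEQ_const_iff)
qed

text \<open>The running minima \<open>m\<^sub>n = min {S\<^sub>0, \<dots>, S\<^sub>n}\<close> satisfy \<open>m\<^sub>n\<^sub>+\<^sub>1 = min 0 (g + m\<^sub>n \<circ> T)\<close> and decrease, so
  \<open>min (- m\<^sub>n \<circ> T) g = m\<^sub>n\<^sub>+\<^sub>1 - m\<^sub>n \<circ> T\<close> has nonpositive integral; if \<open>m\<^sub>n \<rightarrow> -\<infinity>\<close> this integral tends to
  that of \<open>g\<close>.\<close>
lemma birkhoff_sums_bounded_below:
  fixes g :: "'a \<Rightarrow> real"
  assumes int: "integrable M g" and pos: "0 < (\<integral>\<omega>. g \<omega> \<partial>M)"
  shows "AE \<omega> in M. bdd_below (range (\<lambda>n. \<Sum>k<n. g ((T ^^ k) \<omega>)))"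
proof -
  have [measurable]: "g \<in> borel_measurable M" using int by auto
  have [measurable]: "T ^^ k \<in> M \<rightarrow>\<^sub>M M" for k by (simp add: measurable_compose_n)
  define s where "s n \<omega> = (\<Sum>k<n. g ((T ^^ k) \<omega>))" for n \<omega>
  have s_meas [measurable]: "s n \<in> borel_measurable M" for n unfolding s_def by measurable
  have s_Suc: "s (Suc n) \<omega> = g \<omega> + s n (T \<omega>)" for n \<omega>
    unfolding s_def by (subst sum.lessThan_Suc_shift) (simp add: funpow_Suc_right del: funpow.simps(2))
  define A where "A = {\<omega> \<in> space M. \<forall>C::nat. \<exists>n. s n \<omega> < - real C}"
  have [measurable]: "A \<in> sets M" unfolding A_def by measurable
  have unb: "\<omega> \<in> A \<longleftrightarrow> \<omega> \<in> space M \<and> \<not> bdd_below (range (\<lambda>n. s n \<omega>))" for \<omega>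
  proof -
    have "(\<forall>C::nat. \<exists>n. s n \<omega> < - real C) \<longleftrightarrow> (\<forall>C. \<exists>n. s n \<omega> < C)"
    proof safe
      fix C :: real assume "\<forall>C::nat. \<exists>n. s n \<omega> < - real C"
      then obtain n where "s n \<omega> < - real (nat \<lceil>- C\<rceil>)" by blast
      also have "\<dots> \<le> C" by linarith
      finally show "\<exists>n. s n \<omega> < C" ..
    qed auto
    then show ?thesis by (auto simp: A_def bdd_below_def not_le)
  qed
  have step: "T \<omega> \<in> A" if "\<omega> \<in> A" for \<omega>
  proof -
    have "bdd_below (range (\<lambda>n. s n \<omega>))" if bdd: "bdd_below (range (\<lambda>n. s n (T \<omega>)))"
    proof -
      obtain C :: real where C: "\<And>n. C \<le> s n (T \<omega>)" using bdd by (auto simp: bdd_below_def)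
      have "min 0 (g \<omega> + C) \<le> s n \<omega>" for n
        using C[of "n - 1"] s_Suc[of "n - 1" \<omega>] by (cases n) (auto simp: s_def)
      then show ?thesis by (auto simp: bdd_below_def)
    qed
    then show ?thesis using that by (auto simp: unb)
  qed
  \<comment> \<open>Unboundedness passes from \<omega> to \<open>T \<omega>\<close>, so by
    \<open>zero_one\<close> it suffices to exclude that it holds almost surely.\<close>
  have "\<not> (AE \<omega> in M. \<omega> \<in> A)"
  proof
    assume A: "AE \<omega> in M. \<omega> \<in> A"
    define m where "m = rec_nat (\<lambda>\<omega>. 0) (\<lambda>n f \<omega>. min 0 (g \<omega> + f (T \<omega>)))"
    have m_0: "m 0 = (\<lambda>\<omega>. 0)" and m_Suc: "m (Suc n) = (\<lambda>\<omega>. min 0 (g \<omega> + m n (T \<omega>)))" for n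
      by (simp_all add: m_def)
    have m_nonpos: "m n \<omega> \<le> 0" for n \<omega> by (cases n) (auto simp: m_0 m_Suc)
    have m_int: "integrable M (m n)" for n
    proof (induction n)
      case (Suc n)
      show ?case unfolding m_Suc
        using int integrable_T[OF Suc] by (intro integrable_min) auto
    qed (simp add: m_0)
    then have [measurable]: "m n \<in> borel_measurable M" for n by auto
    have m_dec: "m (Suc n) \<omega> \<le> m n \<omega>" for n \<omega>
    proof (induction n arbitrary: \<omega>)
      case (Suc n)
      show ?case using Suc[of "T \<omega>"] by (subst (1 2) m_Suc) auto
    qed (simp add: m_0 m_Suc)
    then have m_antimono: "k \<le> n \<Longrightarrow> m n \<omega> \<le> m k \<omega>" for k n \<omega>
      using lift_Suc_antimono_le[of "\<lambda>n. m n \<omega>"] by blast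
    have m_le_s: "m n \<omega> \<le> s n \<omega>" for n \<omega>
    proof (induction n arbitrary: \<omega>)
      case (Suc n)
      then show ?case by (simp add: s_Suc m_Suc min.coboundedI2)
    qed (simp add: m_0 s_def)
    define r where "r n \<omega> = min (- m n (T \<omega>)) (g \<omega>)" for n \<omega>
    have r_eq: "r n \<omega> = m (Suc n) \<omega> - m n (T \<omega>)" for n \<omega> by (auto simp: r_def m_Suc)
    have "(\<integral>\<omega>. r n \<omega> \<partial>M) \<le> 0" for n
    proof -
      have "(\<integral>\<omega>. r n \<omega> \<partial>M) = (\<integral>\<omega>. m (Suc n) \<omega> \<partial>M) - (\<integral>\<omega>. m n \<omega> \<partial>M)"
        using m_int integrable_T[OF m_int] integral_T[of "m n"] by (simp add: r_eq)
      also have "\<dots> \<le> 0"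
        using integral_mono[OF m_int m_int m_dec] by simp
      finally show ?thesis .
    qed
    moreover have "(\<lambda>n. \<integral>\<omega>. r n \<omega> \<partial>M) \<longlonglongrightarrow> (\<integral>\<omega>. g \<omega> \<partial>M)"
    proof (rule integral_dominated_convergence[where w = "\<lambda>\<omega>. \<bar>g \<omega>\<bar>"])
      show "AE \<omega> in M. (\<lambda>n. r n \<omega>) \<longlonglongrightarrow> g \<omega>"
        using AE_T[OF A]
      proof eventually_elim
        case (elim \<omega>)
        then obtain k where "s k (T \<omega>) < - real (nat \<lceil>g \<omega>\<rceil>)"
          unfolding A_def by blast
        then have "m k (T \<omega>) \<le> - g \<omega>" using m_le_s[of k "T \<omega>"] by linarith
        then have "r n \<omega> = g \<omega>" if "k \<le> n" for n
          using m_antimono[OF that, of "T \<omega>"] by (auto simp: r_def)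
        then show ?case
          by (intro tendsto_eventually eventually_sequentiallyI)
      qed
      show "AE \<omega> in M. norm (r n \<omega>) \<le> \<bar>g \<omega>\<bar>" for n
      proof (rule AE_I2)
        fix \<omega>
        show "norm (r n \<omega>) \<le> \<bar>g \<omega>\<bar>"
          using m_nonpos[of n "T \<omega>"] by (simp add: r_def)
      qed
    qed (use int in \<open>auto simp: r_def\<close>)
    ultimately have "(\<integral>\<omega>. g \<omega> \<partial>M) \<le> 0"
      by (intro LIMSEQ_le_const2) auto
    with pos show False by simp
  qed
  with zero_one[of A] step have "AE \<omega> in M. \<omega> \<notin> A" by auto
  with AE_space show ?thesis
    by eventually_elim (auto simp: unb s_def)
qed

text \<open>\<open>D\<close> is the infimum of all Birkhoff sums of \<open>g\<close>, the empty one
  included; splitting off the first summand gives the recursion. It serves as a potential that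
  absorbs the sum of \<open>g\<close> along an orbit.\<close>

lemma birkhoff_infimum:
  fixes g :: "'a \<Rightarrow> real"
  assumes int: "integrable M g" and pos: "0 < (\<integral>\<omega>. g \<omega> \<partial>M)"
  obtains D :: "'a \<Rightarrow> real" where "AE \<omega> in M. D \<omega> = min 0 (g \<omega> + D (T \<omega>))"
proof -
  define s where "s n \<omega> = (\<Sum>k<n. g ((T ^^ k) \<omega>))" for n \<omega>
  have s_0: "s 0 \<omega> = 0" for \<omega> by (simp add: s_def)
  have s_Suc: "s (Suc n) \<omega> = g \<omega> + s n (T \<omega>)" for n \<omega>
    unfolding s_def by (subst sum.lessThan_Suc_shift) (simp add: funpow_Suc_right del: funpow.simps(2))
  have bdd: "AE \<omega> in M. bdd_below (range (\<lambda>n. s n \<omega>))"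
    unfolding s_def by (rule birkhoff_sums_bounded_below[OF assms])
  have "AE \<omega> in M. (INF n. s n \<omega>) = min 0 (g \<omega> + (INF n. s n (T \<omega>)))"
    using bdd AE_T[OF bdd]
  proof eventually_elim
    case (elim \<omega>)
    have low: "(INF n. s n \<omega>) \<le> s n \<omega>" and low': "(INF n. s n (T \<omega>)) \<le> s n (T \<omega>)" for n
      using elim by (auto intro: cINF_lower)
    have "(INF n. s n \<omega>) - g \<omega> \<le> (INF n. s n (T \<omega>))"
      using low[of "Suc _"] by (intro cINF_greatest) (auto simp: s_Suc algebra_simps)
    moreover have "(INF n. s n \<omega>) \<le> 0" using low[of 0] by (simp add: s_0)
    moreover have "min 0 (g \<omega> + (INF n. s n (T \<omega>))) \<le> s n \<omega>" for n
      using low'[of "n - 1"] by (cases n) (auto simp: s_0 s_Suc)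
    then have "min 0 (g \<omega> + (INF n. s n (T \<omega>))) \<le> (INF n. s n \<omega>)"
      by (intro cINF_greatest) auto
    ultimately show ?case by linarith
  qed
  then show ?thesis by (rule that[of "\<lambda>\<omega>. INF n. s n \<omega>"])
qed

end

subsection \<open>Nearest-neighbour weights\<close>

text \<open>This is the sum, over nearest-neighbour paths of length \<open>n\<close> from 0 to
  \<open>x\<close>, of the product of the weights met: \<open>a\<close> for a step right,
  \<open>b\<close> for a step left. The recursion removes the first step and recentres the
  environment at the new site.\<close>

primrec point_weight ::
    "('a \<Rightarrow> 'a) \<Rightarrow> ('a \<Rightarrow> 'a) \<Rightarrow> ('a \<Rightarrow> real) \<Rightarrow> ('a \<Rightarrow> real) \<Rightarrow> nat \<Rightarrow> 'a \<Rightarrow> int \<Rightarrow> real" where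
  "point_weight T S a b 0 \<omega> x = of_bool (x = 0)"
| "point_weight T S a b (Suc n) \<omega> x =
     a \<omega> * point_weight T S a b n (T \<omega>) (x - 1) + b \<omega> * point_weight T S a b n (S \<omega>) (x + 1)"

primrec total_weight ::
    "('a \<Rightarrow> 'a) \<Rightarrow> ('a \<Rightarrow> 'a) \<Rightarrow> ('a \<Rightarrow> real) \<Rightarrow> ('a \<Rightarrow> real) \<Rightarrow> nat \<Rightarrow> 'a \<Rightarrow> real" where
  "total_weight T S a b 0 \<omega> = 1"
| "total_weight T S a b (Suc n) \<omega> =
     a \<omega> * total_weight T S a b n (T \<omega>) + b \<omega> * total_weight T S a b n (S \<omega>)"

definition orbit :: "('a \<Rightarrow> 'a) \<Rightarrow> ('a \<Rightarrow> 'a) \<Rightarrow> int \<Rightarrow> 'a \<Rightarrow> 'a" where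
  "orbit T S x \<omega> = (if 0 \<le> x then (T ^^ nat x) \<omega> else (S ^^ nat (- x)) \<omega>)"

text \<open>Mirroring paths exchanges \<open>(T, a)\<close> with \<open>(S, b)\<close>; this
  transfers arguments about endpoints on the right to endpoints on the left.\<close>

lemma point_weight_reflect:
  "point_weight S T b a n \<omega> (- x) = point_weight T S a b n \<omega> x"
proof (induction n arbitrary: \<omega> x)
  case (Suc n)
  have "- x - 1 = - (x + 1)" "- x + 1 = - (x - 1)" by simp_all
  then show ?case by (simp only: point_weight.simps Suc add.commute)
qed simp

lemma total_weight_reflect: "total_weight S T b a n \<omega> = total_weight T S a b n \<omega>"
  by (induction n arbitrary: \<omega>) simp_all

lemma point_weight_eq_0: "int n < \<bar>x\<bar> \<Longrightarrow> point_weight T S a b n \<omega> x = 0"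
  by (induction n arbitrary: \<omega> x) auto

text \<open>Any finite set containing the reachable sites is allowed, because the two terms of the
  recursion shift the index set in opposite directions.\<close>

lemma sum_point_weight:
  assumes "finite A" "{- int n..int n} \<subseteq> A"
  shows "(\<Sum>x\<in>A. point_weight T S a b n \<omega> x) = total_weight T S a b n \<omega>"
  using assms
proof (induction n arbitrary: \<omega> A)
  case 0
  then show ?case by (simp add: of_bool_def sum.delta)
next
  case (Suc n)
  have shift: "(\<Sum>x\<in>A. point_weight T S a b n \<eta> (x + d)) = total_weight T S a b n \<eta>"
    if "\<bar>d\<bar> = 1" for \<eta> d
  proof -
    have "(\<Sum>x\<in>A. point_weight T S a b n \<eta> (x + d)) = (\<Sum>y\<in>(\<lambda>x. x + d) ` A. point_weight T S a b n \<eta> y)"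
      by (subst sum.reindex) (auto simp: inj_on_def)
    moreover have "{- int n..int n} \<subseteq> (\<lambda>x. x + d) ` A"
    proof
      fix y assume "y \<in> {- int n..int n}"
      then have "y - d \<in> A" using that by (intro subsetD[OF Suc.prems(2)]) auto
      then show "y \<in> (\<lambda>x. x + d) ` A" by (rule rev_image_eqI) simp
    qed
    ultimately show ?thesis using Suc.IH[of "(\<lambda>x. x + d) ` A"] Suc.prems(1) by simp
  qed
  show ?case
    using shift[of "-1" "T \<omega>"] shift[of 1 "S \<omega>"]
    by (simp add: sum.distrib sum_distrib_left[symmetric])
qed

section \<open>Weighted environments and their growth rate\<close>

text \<open>The assumptions are symmetric under reflection. The constant \<open>\<kappa>\<close>
  yields a deterministic lower bound on \<open>Z\<close>, which makes \<open>Z\<close> positive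
  everywhere and handles the final stretch in \<open>right_unbounded_lower\<close>.\<close>

locale weighted_environment = ergodic_automorphism M T S for M :: "'a measure" and T S +
  fixes a b :: "'a \<Rightarrow> real" and \<kappa> :: real
  assumes a_measurable [measurable]: "a \<in> borel_measurable M"
    and b_measurable [measurable]: "b \<in> borel_measurable M"
    and nonneg: "\<And>\<omega>. \<omega> \<in> space M \<Longrightarrow> 0 \<le> a \<omega> \<and> 0 \<le> b \<omega>"
    and pos: "AE \<omega> in M. 0 < a \<omega> \<and> 0 < b \<omega>"
    and ln_a: "integrable M (\<lambda>\<omega>. ln (a \<omega>))"
    and ln_b: "integrable M (\<lambda>\<omega>. ln (b \<omega>))"
    and sum_lower: "\<And>\<omega>. \<omega> \<in> space M \<Longrightarrow> exp (- \<kappa>) \<le> a \<omega> + b \<omega>"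
begin

abbreviation "W \<equiv> point_weight T S a b"
abbreviation "Z \<equiv> total_weight T S a b"

lemma reflected_environment: "weighted_environment M S T b a \<kappa>"
proof -
  interpret inv: ergodic_automorphism M S T by (rule inverse_automorphism)
  show ?thesis
    by unfold_locales (use nonneg pos ln_a ln_b sum_lower in \<open>auto simp: add.commute\<close>)
qed

lemma W_nonneg: "\<omega> \<in> space M \<Longrightarrow> 0 \<le> W n \<omega> x"
  by (induction n arbitrary: \<omega> x) (auto simp: nonneg)

lemma W_measurable [measurable]: "(\<lambda>\<omega>. W n \<omega> x) \<in> borel_measurable M"
proof (induction n arbitrary: x)
  case (Suc n)
  note Suc [measurable]
  show ?case by simp
qed simp

lemma Z_measurable [measurable]: "Z n \<in> borel_measurable M"
proof (induction n)
  case (Suc n)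
  note Suc [measurable]
  show ?case by simp
qed simp

lemma Z_lower: "\<omega> \<in> space M \<Longrightarrow> exp (- \<kappa> * real n) \<le> Z n \<omega>"
proof (induction n arbitrary: \<omega>)
  case (Suc n)
  have "exp (- \<kappa> * real (Suc n)) = exp (- \<kappa>) * exp (- \<kappa> * real n)"
    by (simp add: exp_add[symmetric] algebra_simps)
  also have "\<dots> \<le> (a \<omega> + b \<omega>) * exp (- \<kappa> * real n)"
    using sum_lower[OF Suc.prems] by (intro mult_right_mono) auto
  also have "\<dots> = a \<omega> * exp (- \<kappa> * real n) + b \<omega> * exp (- \<kappa> * real n)"
    by (simp add: algebra_simps)
  also have "\<dots> \<le> Z (Suc n) \<omega>"
    using Suc nonneg[OF Suc.prems] by (auto intro!: add_mono mult_left_mono)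
  finally show ?case .
qed simp

lemma Z_pos: "\<omega> \<in> space M \<Longrightarrow> 0 < Z n \<omega>"
  by (rule less_le_trans[OF exp_gt_zero Z_lower])

lemma Z_Suc_ge:
  assumes "\<omega> \<in> space M"
  shows "a \<omega> * Z n (T \<omega>) \<le> Z (Suc n) \<omega>"
  using assms nonneg[OF assms] Z_pos[of "S \<omega>" n] by simp

lemma orbit_space: "\<omega> \<in> space M \<Longrightarrow> orbit T S x \<omega> \<in> space M"
proof -
  have "\<omega> \<in> space M \<Longrightarrow> (T ^^ k) \<omega> \<in> space M" "\<omega> \<in> space M \<Longrightarrow> (S ^^ k) \<omega> \<in> space M" for k
    by (induction k) auto
  then show "\<omega> \<in> space M \<Longrightarrow> orbit T S x \<omega> \<in> space M" by (auto simp: orbit_def)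
qed

lemma orbit_T: "\<omega> \<in> space M \<Longrightarrow> orbit T S (x - 1) (T \<omega>) = orbit T S x \<omega>"
proof -
  assume \<omega>: "\<omega> \<in> space M"
  consider "1 \<le> x" | "x \<le> 0" by linarith
  then show ?thesis
  proof cases
    case 1
    then have "nat x = Suc (nat (x - 1))" by simp
    then show ?thesis
      using 1 by (simp add: orbit_def funpow_Suc_right del: funpow.simps(2))
  next
    case 2
    then have "nat (1 - x) = Suc (nat (- x))" by simp
    then show ?thesis
      using 2 \<omega> by (simp add: orbit_def funpow_Suc_right ST del: funpow.simps(2))
  qed
qed

lemma orbit_S: "\<omega> \<in> space M \<Longrightarrow> orbit T S (x + 1) (S \<omega>) = orbit T S x \<omega>"
  using orbit_T[of "S \<omega>" "x + 1"] by (simp add: TS)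

text \<open>Keep only the paths that are at \<open>x\<close> at time \<open>n\<close>; each
  continues as a path of length \<open>m\<close> in the environment seen from
  \<open>x\<close>.\<close>

lemma Z_add_ge:
  "\<omega> \<in> space M \<Longrightarrow> W n \<omega> x * Z m (orbit T S x \<omega>) \<le> Z (n + m) \<omega>"
proof (induction n arbitrary: \<omega> x)
  case 0
  then show ?case
    using Z_pos[of \<omega> m] by (auto simp: of_bool_def orbit_def)
next
  case (Suc n)
  have "a \<omega> * (W n (T \<omega>) (x - 1) * Z m (orbit T S x \<omega>)) \<le> a \<omega> * Z (n + m) (T \<omega>)"
    using Suc.IH[of "T \<omega>" "x - 1"] Suc.prems nonneg[OF Suc.prems]
    by (intro mult_left_mono) (auto simp: orbit_T)
  moreover have "b \<omega> * (W n (S \<omega>) (x + 1) * Z m (orbit T S x \<omega>)) \<le> b \<omega> * Z (n + m) (S \<omega>)"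
    using Suc.IH[of "S \<omega>" "x + 1"] Suc.prems nonneg[OF Suc.prems]
    by (intro mult_left_mono) (auto simp: orbit_S)
  ultimately show ?case by (simp add: algebra_simps)
qed

text \<open>\<open>D = min D\<^sub>+ D\<^sub>-\<close> is the infimum over \<open>x \<in> \<int>\<close> of \<open>f(x) + \<epsilon> |x|\<close>, where \<open>f\<close> is the potential along
  the orbit with increments \<open>F\<^sub>+\<close> and \<open>F\<^sub>-\<close>.\<close>
lemma Z_upper:
  assumes K: "(Fp, Fm) \<in> classK M T"
    and le: "AE \<omega> in M. a \<omega> * exp (Fp \<omega>) + b \<omega> * exp (Fm \<omega>) \<le> exp c"
    and \<epsilon>: "0 < \<epsilon>"
  shows "AE \<omega> in M. \<exists>C. \<forall>n. Z n \<omega> \<le> exp ((c + \<epsilon>) * real n + C)"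
proof -
  interpret inv: ergodic_automorphism M S T by (rule inverse_automorphism)
  have K': "integrable M Fp" "integrable M Fm" "integral\<^sup>L M Fp = 0" "integral\<^sup>L M Fm = 0"
    and cocycle: "AE \<omega> in M. Fp \<omega> + Fm (T \<omega>) = 0"
    using K by (auto simp: classK_def)
  \<comment> \<open>\<open>Fp\<close> and \<open>Fm\<close> have mean zero, so adding \<epsilon>
    makes the means positive, as \<open>birkhoff_infimum\<close> requires.\<close>
  obtain Dp where Dp: "AE \<omega> in M. Dp \<omega> = min 0 (Fp \<omega> + \<epsilon> + Dp (T \<omega>))"
    using K' \<epsilon> by (rule_tac birkhoff_infimum[of "\<lambda>\<omega>. Fp \<omega> + \<epsilon>"]) (auto simp: prob_space)
  obtain Dm where Dm: "AE \<omega> in M. Dm \<omega> = min 0 (Fm \<omega> + \<epsilon> + Dm (S \<omega>))"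
    using K' \<epsilon> by (rule_tac inv.birkhoff_infimum[of "\<lambda>\<omega>. Fm \<omega> + \<epsilon>"]) (auto simp: prob_space)
  have "AE \<omega> in M. (Dp \<omega> = min 0 (Fp \<omega> + \<epsilon> + Dp (T \<omega>)) \<and> Dm \<omega> = min 0 (Fm \<omega> + \<epsilon> + Dm (S \<omega>)))
      \<and> Fp \<omega> + Fm (T \<omega>) = 0 \<and> a \<omega> * exp (Fp \<omega>) + b \<omega> * exp (Fm \<omega>) \<le> exp c" (is "AE \<omega> in M. ?P \<omega>")
    using Dp Dm cocycle le by eventually_elim simp
  then obtain G where "AE \<omega> in M. \<omega> \<in> G"
    and G: "\<And>\<omega>. \<omega> \<in> G \<Longrightarrow> \<omega> \<in> space M \<and> ?P \<omega> \<and> T \<omega> \<in> G \<and> S \<omega> \<in> G"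
    by (rule invariant_full_set) blast
  define D where "D \<omega> = min (Dp \<omega>) (Dm \<omega>)" for \<omega>
  \<comment> \<open>The recursion of \<open>Dp\<close> settles the case where \<open>Dp\<close>
    attains the minimum at \<open>T \<omega>\<close>. For \<open>Dm\<close> the step is undone: the
    increments cancel by the cocycle relation and 2\<epsilon> is left over. If
    \<open>Dm (T \<omega>)\<close> is 0, then \<open>Dp (T \<omega>)\<close> is no larger.\<close>
  have D_T: "D \<omega> \<le> Fp \<omega> + \<epsilon> + D (T \<omega>)" if "\<omega> \<in> G" for \<omega>
  proof -
    have "S (T \<omega>) = \<omega>" using G[OF that] ST by blast
    then have "Dm (T \<omega>) = min 0 (Fm (T \<omega>) + \<epsilon> + Dm \<omega>)"
      using G[OF that] G[of "T \<omega>"] by metis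
    moreover have "Dp (T \<omega>) \<le> 0" using G[OF that] G[of "T \<omega>"] by linarith
    moreover have "Dp \<omega> = min 0 (Fp \<omega> + \<epsilon> + Dp (T \<omega>))" "Fp \<omega> + Fm (T \<omega>) = 0"
      using G[OF that] by blast+
    ultimately show ?thesis using \<epsilon> unfolding D_def by linarith
  qed
  have D_S: "D \<omega> \<le> Fm \<omega> + \<epsilon> + D (S \<omega>)" if "\<omega> \<in> G" for \<omega>
  proof -
    have "T (S \<omega>) = \<omega>" using G[OF that] TS by blast
    then have "Dp (S \<omega>) = min 0 (Fp (S \<omega>) + \<epsilon> + Dp \<omega>)" "Fp (S \<omega>) + Fm \<omega> = 0"
      using G[OF that] G[of "S \<omega>"] by metis+
    moreover have "Dm (S \<omega>) \<le> 0" using G[OF that] G[of "S \<omega>"] by linarith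
    moreover have "Dm \<omega> = min 0 (Fm \<omega> + \<epsilon> + Dm (S \<omega>))"
      using G[OF that] by blast
    ultimately show ?thesis using \<epsilon> unfolding D_def by linarith
  qed
  \<comment> \<open>\<open>exp (- D)\<close> is a supersolution at rate
    \<open>c + \<epsilon>\<close>, and it is at least 1, which starts the induction.\<close>
  have bound: "Z n \<omega> \<le> exp ((c + \<epsilon>) * real n + - D \<omega>)" if "\<omega> \<in> G" for n \<omega>
    using that
  proof (induction n arbitrary: \<omega>)
    case 0
    then show ?case using G[OF 0] by (auto simp: D_def)
  next
    case (Suc n)
    let ?e = "(c + \<epsilon>) * real n + - D \<omega> + \<epsilon>"
    have nn: "0 \<le> a \<omega>" "0 \<le> b \<omega>" using nonneg G[OF Suc.prems] by auto
    have "Z n (T \<omega>) \<le> exp ((c + \<epsilon>) * real n + - D (T \<omega>))" using Suc G by blast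
    also have "\<dots> \<le> exp (?e + Fp \<omega>)" using D_T[OF Suc.prems] by simp
    finally have T: "a \<omega> * Z n (T \<omega>) \<le> a \<omega> * exp (?e + Fp \<omega>)" by (rule mult_left_mono) fact
    have "Z n (S \<omega>) \<le> exp ((c + \<epsilon>) * real n + - D (S \<omega>))" using Suc G by blast
    also have "\<dots> \<le> exp (?e + Fm \<omega>)" using D_S[OF Suc.prems] by simp
    finally have S: "b \<omega> * Z n (S \<omega>) \<le> b \<omega> * exp (?e + Fm \<omega>)" by (rule mult_left_mono) fact
    have "Z (Suc n) \<omega> \<le> exp ?e * (a \<omega> * exp (Fp \<omega>) + b \<omega> * exp (Fm \<omega>))"
      using T S unfolding exp_add[of ?e] by (simp add: algebra_simps)
    also have "\<dots> \<le> exp ?e * exp c" using G[OF Suc.prems] by simp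
    also have "\<dots> = exp ((c + \<epsilon>) * real (Suc n) + - D \<omega>)"
      by (simp add: exp_add[symmetric] algebra_simps)
    finally show ?case .
  qed
  from \<open>AE \<omega> in M. \<omega> \<in> G\<close> show ?thesis
    by eventually_elim (use bound in blast)
qed

text \<open>The resolvent \<open>U = \<Sum>\<^sub>n e\<^bsup>-cn\<^esup> Z\<^sub>n\<close> satisfies \<open>a U \<circ> T + b U \<circ> S \<le> e\<^bsup>c\<^esup> U\<close>, and this inequality alone makes
  the coboundary of \<open>ln U\<close> integrable.\<close>
lemma resolvent_coboundary:
  assumes sumZ: "AE \<omega> in M. summable (\<lambda>n. exp (- c * real n) * Z n \<omega>)"
  shows "\<exists>Fp Fm. (Fp, Fm) \<in> classK M T \<and>
    (AE \<omega> in M. a \<omega> * exp (Fp \<omega>) + b \<omega> * exp (Fm \<omega>) \<le> exp c)"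
proof -
  interpret inv: ergodic_automorphism M S T by (rule inverse_automorphism)
  define z where "z n \<omega> = exp (- c * real n) * Z n \<omega>" for n \<omega>
  have [measurable]: "z n \<in> borel_measurable M" for n unfolding z_def by measurable
  define U where "U \<omega> = (\<Sum>n. z n \<omega>)" for \<omega>
  have [measurable]: "U \<in> borel_measurable M" unfolding U_def by measurable
  from sumZ pos have "AE \<omega> in M. summable (\<lambda>n. z n \<omega>) \<and> 0 < a \<omega> \<and> 0 < b \<omega>"
    by eventually_elim (simp add: z_def)
  then obtain G where AE_G: "AE \<omega> in M. \<omega> \<in> G"
    and G: "\<And>\<omega>. \<omega> \<in> G \<Longrightarrow> \<omega> \<in> space M \<and> (summable (\<lambda>n. z n \<omega>) \<and> 0 < a \<omega> \<and> 0 < b \<omega>) \<and> T \<omega> \<in> G \<and> S \<omega> \<in> G"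
    by (rule invariant_full_set) blast
  have z_Suc: "exp c * z (Suc n) \<omega> = a \<omega> * z n (T \<omega>) + b \<omega> * z n (S \<omega>)" for n \<omega>
  proof -
    have "exp c * exp (- c * real (Suc n)) = exp (- c * real n)"
      by (simp add: exp_add[symmetric] algebra_simps)
    then have "exp c * z (Suc n) \<omega> = exp (- c * real n) * Z (Suc n) \<omega>"
      by (simp add: z_def mult.assoc[symmetric] del: total_weight.simps)
    then show ?thesis by (simp add: z_def algebra_simps)
  qed
  \<comment> \<open>Shifting the index reproduces the series without its term \<open>n = 0\<close>;
    that term leaves the surplus \<open>exp c\<close> and the bound
    \<open>1 \<le> U \<omega>\<close>.\<close>
  have U_eq: "exp c * U \<omega> = exp c + a \<omega> * U (T \<omega>) + b \<omega> * U (S \<omega>)" and U_ge: "1 \<le> U \<omega>"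
    if "\<omega> \<in> G" for \<omega>
  proof -
    have sm: "summable (\<lambda>n. z n \<omega>)" "summable (\<lambda>n. z n (T \<omega>))" "summable (\<lambda>n. z n (S \<omega>))"
      using G that by blast+
    have sm': "summable (\<lambda>n. z (Suc n) \<omega>)"
      using sm(1) summable_Suc_iff[of "\<lambda>n. z n \<omega>"] by blast
    have "U \<omega> = 1 + (\<Sum>n. z (Suc n) \<omega>)"
      using suminf_split_head[OF sm(1)] by (simp add: U_def z_def)
    moreover have "exp c * (\<Sum>n. z (Suc n) \<omega>) = (\<Sum>n. a \<omega> * z n (T \<omega>) + b \<omega> * z n (S \<omega>))"
      using sm' by (subst suminf_mult[symmetric]) (simp_all add: z_Suc)
    moreover have "\<dots> = a \<omega> * U (T \<omega>) + b \<omega> * U (S \<omega>)"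
      using sm by (subst suminf_add[symmetric]) (auto simp: suminf_mult U_def summable_mult)
    ultimately show "exp c * U \<omega> = exp c + a \<omega> * U (T \<omega>) + b \<omega> * U (S \<omega>)"
      by (simp add: algebra_simps)
    have "0 \<le> (\<Sum>n. z (Suc n) \<omega>)"
      using sm' G[OF that] Z_pos
      by (intro suminf_nonneg) (auto simp: z_def less_imp_le simp del: total_weight.simps)
    then show "1 \<le> U \<omega>" using \<open>U \<omega> = 1 + (\<Sum>n. z (Suc n) \<omega>)\<close> by simp
  qed
  have U_T: "ln (a \<omega>) + ln (U (T \<omega>)) \<le> c + ln (U \<omega>)" "ln (b \<omega>) + ln (U (S \<omega>)) \<le> c + ln (U \<omega>)"
    if "\<omega> \<in> G" for \<omega>
  proof -
    have U1: "1 \<le> U \<omega>" "1 \<le> U (T \<omega>)" "1 \<le> U (S \<omega>)" using U_ge G that by blast+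
    have ab: "0 < a \<omega>" "0 < b \<omega>" using G[OF that] by blast+
    then have *: "0 \<le> a \<omega> * U (T \<omega>)" "0 \<le> b \<omega> * U (S \<omega>)" using U1 by auto
    have "a \<omega> * U (T \<omega>) \<le> exp c * U \<omega>" "b \<omega> * U (S \<omega>) \<le> exp c * U \<omega>"
      using U_eq[OF that] * exp_gt_zero[of c] by linarith+
    then have "ln (a \<omega> * U (T \<omega>)) \<le> ln (exp c * U \<omega>)" "ln (b \<omega> * U (S \<omega>)) \<le> ln (exp c * U \<omega>)"
      using U1 ab by (simp_all add: ln_le_cancel_iff)
    then show "ln (a \<omega>) + ln (U (T \<omega>)) \<le> c + ln (U \<omega>)" "ln (b \<omega>) + ln (U (S \<omega>)) \<le> c + ln (U \<omega>)"
      using U1 ab by (simp_all add: ln_mult)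
  qed
  define Fp where "Fp \<omega> = ln (U (T \<omega>)) - ln (U \<omega>)" for \<omega>
  define Fm where "Fm \<omega> = ln (U (S \<omega>)) - ln (U \<omega>)" for \<omega>
  \<comment> \<open>The inequality for \<open>a\<close> at \<omega> bounds the increment of
    \<open>ln U\<close> from above, the one for \<open>b\<close> at \<open>T \<omega>\<close> from
    below. Integrability of \<open>ln U\<close> itself is not claimed.\<close>
  have int_p: "integrable M Fp"
  proof (rule Bochner_Integration.integrable_bound)
    show "integrable M (\<lambda>\<omega>. \<bar>c\<bar> + \<bar>ln (a \<omega>)\<bar> + \<bar>ln (b (T \<omega>))\<bar>)"
      using ln_a integrable_T[OF ln_b] by auto
    show "AE \<omega> in M. norm (Fp \<omega>) \<le> norm (\<bar>c\<bar> + \<bar>ln (a \<omega>)\<bar> + \<bar>ln (b (T \<omega>))\<bar>)"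
      using AE_G
    proof eventually_elim
      case (elim \<omega>)
      then show ?case
        using U_T(1)[of \<omega>] U_T(2)[of "T \<omega>"] G[of \<omega>] ST[of \<omega>] by (auto simp: Fp_def)
    qed
  qed (unfold Fp_def, measurable)
  have int_m: "integrable M Fm"
  proof (rule Bochner_Integration.integrable_bound)
    show "integrable M (\<lambda>\<omega>. \<bar>c\<bar> + \<bar>ln (b \<omega>)\<bar> + \<bar>ln (a (S \<omega>))\<bar>)"
      using ln_b inv.integrable_T[OF ln_a] by auto
    show "AE \<omega> in M. norm (Fm \<omega>) \<le> norm (\<bar>c\<bar> + \<bar>ln (b \<omega>)\<bar> + \<bar>ln (a (S \<omega>))\<bar>)"
      using AE_G
    proof eventually_elim
      case (elim \<omega>)
      then show ?case
        using U_T(2)[of \<omega>] U_T(1)[of "S \<omega>"] G[of \<omega>] TS[of \<omega>] by (auto simp: Fm_def)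
    qed
  qed (unfold Fm_def, measurable)
  have "integral\<^sup>L M Fp = 0"
    using coboundary_integral_eq_0[of "\<lambda>\<omega>. ln (U \<omega>)"] int_p unfolding Fp_def by simp
  moreover have "integral\<^sup>L M Fm = 0"
    using inv.coboundary_integral_eq_0[of "\<lambda>\<omega>. ln (U \<omega>)"] int_m unfolding Fm_def by simp
  moreover have "AE \<omega> in M. Fp \<omega> + Fm (T \<omega>) = 0"
    using AE_space by eventually_elim (simp add: Fp_def Fm_def ST)
  ultimately have "(Fp, Fm) \<in> classK M T"
    using int_p int_m by (simp add: classK_def)
  moreover have "AE \<omega> in M. a \<omega> * exp (Fp \<omega>) + b \<omega> * exp (Fm \<omega>) \<le> exp c"
    using AE_G
  proof eventually_elim
    case (elim \<omega>)
    have U1: "1 \<le> U \<omega>" "1 \<le> U (T \<omega>)" "1 \<le> U (S \<omega>)" using U_ge G elim by blast+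
    have "a \<omega> * exp (Fp \<omega>) + b \<omega> * exp (Fm \<omega>) = (a \<omega> * U (T \<omega>) + b \<omega> * U (S \<omega>)) / U \<omega>"
      using U1 by (simp add: Fp_def Fm_def exp_diff add_divide_distrib)
    also have "\<dots> \<le> exp c"
      using U1 U_eq[OF elim] exp_gt_zero[of c] by (simp add: divide_le_eq)
    finally show ?case .
  qed
  ultimately show ?thesis by blast
qed

section \<open>The lower bound\<close>

text \<open>Growth is required at a single endpoint, since the endpoint determines the environment
  in which the next segment starts. Natural bounds \<open>C\<close> make the event a countable
  combination of measurable ones.\<close>

definition right_unbounded :: "real \<Rightarrow> 'a \<Rightarrow> bool" where
  "right_unbounded c \<omega> \<longleftrightarrow> (\<forall>C::nat. \<exists>n x. 0 \<le> x \<and> real C * exp (c * real n) < W n \<omega> x)"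

text \<open>One step to the right leads from \<open>S \<omega>\<close> to \<omega>. Prepending it
  keeps the endpoint nonnegative and changes weights by a positive factor, so the event passes to
  \<open>S \<omega>\<close> and the zero-one law for \<open>S\<close> applies.\<close>

lemma right_unbounded_zero_one:
  "(AE \<omega> in M. right_unbounded c \<omega>) \<or> (AE \<omega> in M. \<not> right_unbounded c \<omega>)"
proof -
  interpret inv: ergodic_automorphism M S T by (rule inverse_automorphism)
  define A where "A = {\<omega> \<in> space M. right_unbounded c \<omega>}"
  have A: "A \<in> sets M"
    unfolding A_def right_unbounded_def by measurable
  have "AE \<omega> in M. 0 < a (S \<omega>)"
    using inv.AE_T[OF pos] by eventually_elim simp
  then have "AE \<omega> in M. \<omega> \<in> A \<longrightarrow> S \<omega> \<in> A"
    using AE_space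
  proof eventually_elim
    case (elim \<omega>)
    have "right_unbounded c (S \<omega>)" if R: "right_unbounded c \<omega>"
      unfolding right_unbounded_def
    proof
      fix C :: nat
      \<comment> \<open>This choice compensates the weight \<open>a (S \<omega>)\<close> of the
        prepended step and the factor \<open>exp c\<close> for the extra unit of time.\<close>
      define C' where "C' = nat \<lceil>real C * exp c / a (S \<omega>)\<rceil>"
      obtain n x where x: "0 \<le> x" "real C' * exp (c * real n) < W n \<omega> x"
        using R unfolding right_unbounded_def by blast
      have "real C * exp c / a (S \<omega>) \<le> real C'"
        unfolding C'_def by linarith
      then have "real C * exp c \<le> a (S \<omega>) * real C'"
        using elim by (simp add: pos_divide_le_eq mult.commute)
      then have "real C * exp c * exp (c * real n) \<le> a (S \<omega>) * real C' * exp (c * real n)"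
        by (rule mult_right_mono) simp
      also have "\<dots> < a (S \<omega>) * W n \<omega> x"
        using x(2) elim by (simp add: mult.assoc)
      also have "\<dots> \<le> W (Suc n) (S \<omega>) (x + 1)"
        using elim nonneg[of "S \<omega>"] W_nonneg[of "S (S \<omega>)" n "x + 1 + 1"] by (simp add: TS)
      finally have "real C * exp (c * real (Suc n)) < W (Suc n) (S \<omega>) (x + 1)"
        by (simp add: exp_add algebra_simps)
      then show "\<exists>n x. 0 \<le> x \<and> real C * exp (c * real n) < W n (S \<omega>) x"
        using x(1) by (intro exI[of _ "Suc n"] exI[of _ "x + 1"]) simp
    qed
    then show ?case using elim by (auto simp: A_def)
  qed
  from inv.zero_one[OF A this] show ?thesis
    using AE_space by (auto elim!: eventually_elim2 simp: A_def)
qed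

text \<open>Most sites admit a jump to the right, within a bounded time \<open>N\<close>, whose weight grows at rate \<open>c\<close>.
  Follow these jumps and take single steps to the right from the other sites. Since this
  itinerary never turns back, each exceptional site is used at most once, and the cost of the exceptional
  sites is controlled by the ergodic theorem.\<close>
lemma right_unbounded_lower:
  assumes R: "AE \<omega> in M. right_unbounded c \<omega>" and \<epsilon>: "0 < \<epsilon>"
  shows "AE \<omega> in M. \<exists>C. \<forall>n. exp ((c - \<epsilon>) * real n - C) \<le> Z n \<omega>"
proof -
  define good where "good N \<omega> \<longleftrightarrow>
    (\<exists>n x. 1 \<le> n \<and> n \<le> N \<and> 0 \<le> x \<and> x \<le> int n \<and> exp (c * real n) \<le> W n \<omega> x)" for N :: nat and \<omega>
  have [measurable]: "Measurable.pred M (good N)" for N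
    unfolding good_def by measurable
  \<comment> \<open>A step to the right has weight at least \<open>exp (c - h \<omega>)\<close> when
    \<open>a \<omega>\<close> is positive; thus \<open>g N\<close> bounds the loss against rate
    \<open>c\<close> at a site without a good jump.\<close>
  define h where "h \<omega> = \<bar>c\<bar> + \<bar>ln (a \<omega>)\<bar>" for \<omega>
  define g where "g N \<omega> = (if good N \<omega> then 0 else h \<omega>)" for N \<omega>
  have h: "integrable M h" unfolding h_def using ln_a by auto
  have [measurable]: "h \<in> borel_measurable M" "g N \<in> borel_measurable M" for N
    unfolding g_def h_def by measurable
  have g_nonneg: "0 \<le> g N \<omega>" and g_le: "g N \<omega> \<le> h \<omega>" for N \<omega>
    by (auto simp: g_def h_def)
  have int_g: "integrable M (g N)" for N
    using h by (rule Bochner_Integration.integrable_bound)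
      (use g_nonneg g_le in \<open>auto intro!: AE_I2 order_trans[OF g_le abs_ge_self]\<close>)
  have "(\<lambda>N. \<integral>\<omega>. g N \<omega> \<partial>M) \<longlonglongrightarrow> (\<integral>\<omega>. 0 \<partial>M)"
  proof (rule integral_dominated_convergence[where w = h])
    show "AE \<omega> in M. (\<lambda>N. g N \<omega>) \<longlonglongrightarrow> 0"
      using R
    proof eventually_elim
      case (elim \<omega>)
      \<comment> \<open>With \<open>C = 1\<close> the strict inequality excludes
        \<open>n = 0\<close>, where the weight is at most 1; hence every jump advances time.\<close>
      then obtain n x where x: "0 \<le> x" "real 1 * exp (c * real n) < W n \<omega> x"
        unfolding right_unbounded_def by blast
      then have "W n \<omega> x \<noteq> 0" using exp_gt_zero[of "c * real n"] by auto
      then have "x \<le> int n" using point_weight_eq_0[of n x T S a b \<omega>] by linarith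
      moreover have "1 \<le> n" using x by (cases n) (auto simp: of_bool_def split: if_splits)
      ultimately have "good N \<omega>" if "n \<le> N" for N
        unfolding good_def using x that by (intro exI[of _ n] exI[of _ x]) auto
      then have "g N \<omega> = 0" if "n \<le> N" for N using that by (simp add: g_def)
      then show ?case by (intro tendsto_eventually eventually_sequentiallyI)
    qed
  qed (use h g_nonneg g_le in auto)
  then have "\<forall>\<^sub>F N in sequentially. (\<integral>\<omega>. g N \<omega> \<partial>M) < \<epsilon>"
    using \<epsilon> by (simp add: order_tendstoD)
  then obtain N where N: "(\<integral>\<omega>. g N \<omega> \<partial>M) < \<epsilon>"
    by (auto simp: eventually_sequentially)
  \<comment> \<open>Since \<epsilon> exceeds the mean of \<open>g N\<close>, the losses along an
    orbit amount to at most \<epsilon> per site, up to the potential \<open>D\<close>.\<close>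
  obtain D where D: "AE \<omega> in M. D \<omega> = min 0 (\<epsilon> - g N \<omega> + D (T \<omega>))"
    using N int_g by (rule_tac birkhoff_infimum[of "\<lambda>\<omega>. \<epsilon> - g N \<omega>"]) (auto simp: prob_space)
  have "AE \<omega> in M. D \<omega> = min 0 (\<epsilon> - g N \<omega> + D (T \<omega>)) \<and> 0 < a \<omega>"
    using D pos by eventually_elim simp
  then obtain G where AE_G: "AE \<omega> in M. \<omega> \<in> G"
    and G: "\<And>\<omega>. \<omega> \<in> G \<Longrightarrow> \<omega> \<in> space M \<and> (D \<omega> = min 0 (\<epsilon> - g N \<omega> + D (T \<omega>)) \<and> 0 < a \<omega>) \<and> T \<omega> \<in> G \<and> S \<omega> \<in> G"
    by (rule invariant_full_set) blast
  have D_nonpos: "D \<omega> \<le> 0" and D_T: "D \<omega> \<le> \<epsilon> - g N \<omega> + D (T \<omega>)" if "\<omega> \<in> G" for \<omega>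
    using G[OF that] by linarith+
  have D_pow: "(T ^^ k) \<omega> \<in> G \<and> D \<omega> \<le> \<epsilon> * real k + D ((T ^^ k) \<omega>)" if "\<omega> \<in> G" for k \<omega>
  proof (induction k)
    case (Suc k)
    then show ?case
      using D_T[of "(T ^^ k) \<omega>"] g_nonneg[of N "(T ^^ k) \<omega>"] G[of "(T ^^ k) \<omega>"]
      by (auto simp: algebra_simps)
  qed (use that in simp)
  \<comment> \<open>\<open>K\<close> pays for a final stretch of at most \<open>N\<close> steps,
    where only \<open>Z_lower\<close> is used.\<close>
  define K where "K = (\<bar>c\<bar> + \<bar>\<kappa>\<bar>) * real N"
  have "exp ((c - \<epsilon>) * real t - K + D \<omega>) \<le> Z t \<omega>" if "\<omega> \<in> G" for t \<omega>
    using that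
  proof (induction t arbitrary: \<omega> rule: less_induct)
    case (less t)
    note \<omega> = G[OF less.prems]
    consider "t \<le> N" | "N < t" "good N \<omega>" | "N < t" "\<not> good N \<omega>" by linarith
    then show ?case
    proof cases
      case 1
      have "(c - \<epsilon> + \<kappa>) * real t \<le> (\<bar>c\<bar> + \<bar>\<kappa>\<bar>) * real t"
        using \<epsilon> by (intro mult_right_mono) auto
      also have "\<dots> \<le> K" unfolding K_def using 1 by (intro mult_left_mono) auto
      finally have "(c - \<epsilon>) * real t - K + D \<omega> \<le> - \<kappa> * real t"
        using D_nonpos[OF less.prems] by (simp add: algebra_simps)
      then show ?thesis using Z_lower[of \<omega> t] \<omega> by (meson exp_le_cancel_iff order_trans)
    next
      case 2
      then obtain n x where n: "1 \<le> n" "n \<le> N" "0 \<le> x" "x \<le> int n" "exp (c * real n) \<le> W n \<omega> x"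
        unfolding good_def by blast
      let ?\<eta> = "(T ^^ nat x) \<omega>"
      \<comment> \<open>A jump lasting \<open>n\<close> steps moves at most \<open>n\<close> sites,
        so its duration pays for \<epsilon> per site.\<close>
      have \<eta>: "?\<eta> \<in> G" "D \<omega> \<le> \<epsilon> * real n + D ?\<eta>"
      proof -
        have "\<epsilon> * real (nat x) \<le> \<epsilon> * real n"
          using \<epsilon> n by (intro mult_left_mono) auto
        then show "?\<eta> \<in> G" "D \<omega> \<le> \<epsilon> * real n + D ?\<eta>"
          using D_pow[OF less.prems, of "nat x"] by auto
      qed
      have "(c - \<epsilon>) * real t - K + D \<omega> \<le> c * real n + ((c - \<epsilon>) * real (t - n) - K + D ?\<eta>)"
        using \<eta>(2) n 2 by (simp add: algebra_simps of_nat_diff)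
      then have "exp ((c - \<epsilon>) * real t - K + D \<omega>) \<le> exp (c * real n) * exp ((c - \<epsilon>) * real (t - n) - K + D ?\<eta>)"
        by (simp add: exp_add[symmetric])
      also have "\<dots> \<le> W n \<omega> x * Z (t - n) ?\<eta>"
        using n 2 \<omega> \<eta> less.IH[of "t - n" ?\<eta>] W_nonneg by (intro mult_mono) auto
      also have "\<dots> \<le> Z t \<omega>"
        using Z_add_ge[of \<omega> n x "t - n"] \<omega> n 2 by (simp add: orbit_def)
      finally show ?thesis .
    next
      case 3
      then obtain t' where t': "t = Suc t'" by (cases t) auto
      have "c - g N \<omega> \<le> ln (a \<omega>)" using 3 by (simp add: g_def h_def)
      then have "(c - \<epsilon>) * real t - K + D \<omega> \<le> ln (a \<omega>) + ((c - \<epsilon>) * real t' - K + D (T \<omega>))"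
        using D_T[OF less.prems] by (simp add: t' algebra_simps)
      then have "exp ((c - \<epsilon>) * real t - K + D \<omega>) \<le> exp (ln (a \<omega>) + ((c - \<epsilon>) * real t' - K + D (T \<omega>)))"
        by simp
      also have "\<dots> = a \<omega> * exp ((c - \<epsilon>) * real t' - K + D (T \<omega>))"
        using \<omega> by (simp only: exp_add exp_ln)
      also have "\<dots> \<le> a \<omega> * Z t' (T \<omega>)"
        using \<omega> less.IH[of t' "T \<omega>"] by (intro mult_left_mono) (auto simp: t')
      also have "\<dots> \<le> Z t \<omega>" using Z_Suc_ge[of \<omega> t'] \<omega> by (simp only: t')
      finally show ?thesis .
    qed
  qed
  then have bound: "exp ((c - \<epsilon>) * real n - (K - D \<omega>)) \<le> Z n \<omega>" if "\<omega> \<in> G" for n \<omega>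
    using that by (simp add: algebra_simps)
  from AE_G show ?thesis by eventually_elim (use bound in blast)
qed

text \<open>There are \<open>2 * n + 1\<close> possible endpoints, each with weight of order
  \<open>exp (c * n)\<close>: by \<open>r\<close> on the right, by \<open>l\<close> on the left. The
  larger rate \<open>d\<close> absorbs their number.\<close>

lemma Z_bounded_if_not_unbounded:
  assumes \<omega>: "\<omega> \<in> space M" and c: "c < d"
    and r: "\<not> right_unbounded c \<omega>"
    and l: "\<not> weighted_environment.right_unbounded S T b a c \<omega>"
  shows "\<exists>C::nat. \<forall>n. Z n \<omega> \<le> real C * exp (d * real n)"
proof -
  interpret refl: weighted_environment M S T b a \<kappa> by (rule reflected_environment)
  obtain C1 where C1: "\<And>n x. 0 \<le> x \<Longrightarrow> W n \<omega> x \<le> real C1 * exp (c * real n)"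
    using r unfolding right_unbounded_def by (auto simp: not_less)
  obtain C2 where C2: "\<And>n x. 0 \<le> x \<Longrightarrow> point_weight S T b a n \<omega> x \<le> real C2 * exp (c * real n)"
    using l unfolding refl.right_unbounded_def by (auto simp: not_less)
  have W: "W n \<omega> x \<le> real (C1 + C2) * exp (c * real n)" for n x
  proof (cases "0 \<le> x")
    case True
    then show ?thesis using C1[of x n] by (simp add: distrib_right add_increasing2)
  next
    case False
    then show ?thesis
      using C2[of "- x" n] point_weight_reflect[of S T b a n \<omega> x] by (simp add: distrib_right add_increasing)
  qed
  define \<delta> where "\<delta> = d - c"
  have \<delta>: "0 < \<delta>" using c by (simp add: \<delta>_def)
  define C where "C = real (C1 + C2) * (2 / \<delta> + 1)"
  have "Z n \<omega> \<le> real (nat \<lceil>C\<rceil>) * exp (d * real n)" for n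
  proof -
    have "Z n \<omega> = (\<Sum>x\<in>{- int n..int n}. W n \<omega> x)" by (simp add: sum_point_weight)
    also have "\<dots> \<le> real (card {- int n..int n}) * (real (C1 + C2) * exp (c * real n))"
      by (rule sum_bounded_above) (rule W)
    also have "real (card {- int n..int n}) = 2 * real n + 1" by simp
    also have "2 * real n + 1 \<le> (2 / \<delta> + 1) * exp (\<delta> * real n)"
    proof -
      have "2 * real n = 2 / \<delta> * (\<delta> * real n)" using \<delta> by simp
      also have "\<dots> \<le> 2 / \<delta> * exp (\<delta> * real n)"
        using \<delta> by (intro mult_left_mono less_imp_le[OF exp_gt_self]) auto
      finally show ?thesis
        using \<delta> one_le_exp_iff[of "\<delta> * real n"] by (simp add: distrib_right add_mono)
    qed
    then have "(2 * real n + 1) * (real (C1 + C2) * exp (c * real n)) \<le>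
        (2 / \<delta> + 1) * exp (\<delta> * real n) * (real (C1 + C2) * exp (c * real n))"
      by (rule mult_right_mono) simp
    also have "\<dots> = C * exp (d * real n)"
      by (simp add: C_def \<delta>_def left_diff_distrib exp_diff)
    also have "\<dots> \<le> real (nat \<lceil>C\<rceil>) * exp (d * real n)"
      by (intro mult_right_mono) (linarith, simp)
    finally show ?thesis .
  qed
  then show ?thesis by blast
qed

lemma Z_lower_bound:
  assumes none: "\<And>Fp Fm. (Fp, Fm) \<in> classK M T \<Longrightarrow>
      \<not> (AE \<omega> in M. a \<omega> * exp (Fp \<omega>) + b \<omega> * exp (Fm \<omega>) \<le> exp c)"
    and d: "d < c"
  shows "AE \<omega> in M. \<exists>C. \<forall>n. exp (d * real n - C) \<le> Z n \<omega>"
proof -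
  interpret refl: weighted_environment M S T b a \<kappa> by (rule reflected_environment)
  \<comment> \<open>The gap is split in three: one part makes the resolvent series geometric, one
    absorbs the number of endpoints, one is the loss in
    \<open>right_unbounded_lower\<close>.\<close>
  define \<delta> where "\<delta> = (c - d) / 3"
  have \<delta>: "0 < \<delta>" using d by (simp add: \<delta>_def)
  define c' where "c' = c - \<delta>"
  define A where "A = {\<omega> \<in> space M. \<exists>C::nat. \<forall>n. Z n \<omega> \<le> real C * exp (c' * real n)}"
  have A: "A \<in> sets M" unfolding A_def by measurable
  \<comment> \<open>A first step to the right bounds \<open>Z n (T \<omega>)\<close> by a multiple
    of \<open>Z (Suc n) \<omega>\<close>, so the growth bound is inherited by
    \<open>T \<omega>\<close>.\<close>
  have "AE \<omega> in M. \<omega> \<in> A \<longrightarrow> T \<omega> \<in> A"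
    using pos AE_space
  proof eventually_elim
    case (elim \<omega>)
    have "\<exists>C::nat. \<forall>n. Z n (T \<omega>) \<le> real C * exp (c' * real n)"
      if C: "\<And>n. Z n \<omega> \<le> real C * exp (c' * real n)" for C :: nat
    proof -
      have "Z n (T \<omega>) \<le> real (nat \<lceil>real C * exp c' / a \<omega>\<rceil>) * exp (c' * real n)" for n
      proof -
        have "a \<omega> * Z n (T \<omega>) \<le> real C * exp (c' * real (Suc n))"
          using Z_Suc_ge[of \<omega> n] elim C[of "Suc n"] by linarith
        also have "\<dots> = real C * exp c' * exp (c' * real n)"
          by (simp add: exp_add algebra_simps)
        finally have "Z n (T \<omega>) \<le> real C * exp c' / a \<omega> * exp (c' * real n)"
          using elim by (simp add: field_simps)
        also have "\<dots> \<le> real (nat \<lceil>real C * exp c' / a \<omega>\<rceil>) * exp (c' * real n)"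
          by (intro mult_right_mono) (linarith, simp)
        finally show ?thesis .
      qed
      then show ?thesis by blast
    qed
    then show ?case using elim by (auto simp: A_def)
  qed
  from zero_one[OF A this] have "AE \<omega> in M. \<omega> \<notin> A"
  proof
    assume "AE \<omega> in M. \<omega> \<in> A"
    then have "AE \<omega> in M. summable (\<lambda>n. exp (- c * real n) * Z n \<omega>)"
    proof eventually_elim
      case (elim \<omega>)
      then obtain C :: nat where \<omega>: "\<omega> \<in> space M" and C: "\<And>n. Z n \<omega> \<le> real C * exp (c' * real n)"
        by (auto simp: A_def)
      have "norm (exp (- c * real n) * Z n \<omega>) \<le> real C * exp (- \<delta>) ^ n" for n
      proof -
        have "exp (- c * real n) * Z n \<omega> \<le> exp (- c * real n) * (real C * exp (c' * real n))"
          by (intro mult_left_mono C) simp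
        also have "\<dots> = real C * exp (- \<delta>) ^ n"
          by (simp add: c'_def exp_of_nat_mult[symmetric] exp_add[symmetric] algebra_simps)
        finally show ?thesis using Z_pos[OF \<omega>, of n] by simp
      qed
      then show ?case
        by (rule summable_comparison_test'[rotated, where N = 0])
          (use \<delta> in \<open>auto intro!: summable_mult summable_geometric\<close>)
    qed
    then show ?thesis using resolvent_coboundary none by blast
  qed
  then have unb: "AE \<omega> in M. right_unbounded (c' - \<delta>) \<omega> \<or> refl.right_unbounded (c' - \<delta>) \<omega>"
    using AE_space
  proof eventually_elim
    case (elim \<omega>)
    then show ?case
      using \<delta> Z_bounded_if_not_unbounded[of \<omega> "c' - \<delta>" c'] unfolding A_def by auto
  qed
  have rate: "c' - \<delta> - \<delta> = d" by (simp add: c'_def \<delta>_def field_simps)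
  \<comment> \<open>The unbounded direction could still depend on \<omega>; the zero-one law makes
    one direction work almost everywhere.\<close>
  consider "AE \<omega> in M. right_unbounded (c' - \<delta>) \<omega>" | "AE \<omega> in M. refl.right_unbounded (c' - \<delta>) \<omega>"
  proof (cases "AE \<omega> in M. right_unbounded (c' - \<delta>) \<omega>")
    case False
    then have "AE \<omega> in M. \<not> right_unbounded (c' - \<delta>) \<omega>" using right_unbounded_zero_one by blast
    with unb have "AE \<omega> in M. refl.right_unbounded (c' - \<delta>) \<omega>" by eventually_elim blast
    then show ?thesis using that by blast
  qed (use that in blast)
  then show ?thesis
  proof cases
    case 1
    from right_unbounded_lower[OF this \<delta>] show ?thesis by (simp add: rate)
  next
    case 2
    from refl.right_unbounded_lower[OF this \<delta>] show ?thesis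
      by (simp add: rate total_weight_reflect[of S T b a])
  qed
qed

end

subsection \<open>The quenched free energy\<close>

context weighted_environment
begin

lemma orbit_plus_1: "\<omega> \<in> space M \<Longrightarrow> orbit T S (x + 1) \<omega> = T (orbit T S x \<omega>)"
proof -
  assume \<omega>: "\<omega> \<in> space M"
  consider "0 \<le> x" | "x < 0" by linarith
  then show ?thesis
  proof cases
    case 1
    then have "nat (x + 1) = Suc (nat x)" by simp
    then show ?thesis using 1 by (simp add: orbit_def)
  next
    case 2
    then have "nat (- x) = Suc (nat (- (x + 1)))" by simp
    then have "orbit T S x \<omega> = S (orbit T S (x + 1) \<omega>)" using 2 by (auto simp: orbit_def)
    then show ?thesis using orbit_space[OF \<omega>, of "x + 1"] by (simp add: TS)
  qed
qed

lemma orbit_minus_1: "\<omega> \<in> space M \<Longrightarrow> orbit T S (x - 1) \<omega> = S (orbit T S x \<omega>)"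
  using orbit_plus_1[of \<omega> "x - 1"] orbit_space[of \<omega> "x - 1"] by (simp add: ST)

text \<open>\<open>walk_law\<close> appends a last step while \<open>Z\<close> removes the first.
  The induction therefore weights the walk at time \<open>n\<close> by \<open>Z m\<close> at its
  current site, for all \<open>m\<close>, and moves one step at a time between the two
  factors.\<close>

lemma quenched_mgf_eq:
  assumes S: "\<And>x \<omega>. Tpow M T x \<omega> = orbit T S x \<omega>"
    and pp: "\<And>\<omega>. \<omega> \<in> space M \<Longrightarrow> 0 \<le> pp \<omega> \<and> pp \<omega> \<le> 1"
    and a: "\<And>\<omega>. \<omega> \<in> space M \<Longrightarrow> a \<omega> = pp \<omega> * exp lam"
    and b: "\<And>\<omega>. \<omega> \<in> space M \<Longrightarrow> b \<omega> = (1 - pp \<omega>) * exp (- lam)"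
    and \<omega>: "\<omega> \<in> space M"
  shows "quenched_mgf M T pp \<omega> lam n = Z n \<omega>"
proof -
  let ?p = "walk_law M T pp \<omega>"
  have fin: "finite (set_pmf (?p n))" for n by (induction n) auto
  have "measure_pmf.expectation (?p n) (\<lambda>x. exp (lam * real_of_int x) * Z m (orbit T S x \<omega>)) = Z (n + m) \<omega>"
    for m
  proof (induction n arbitrary: m)
    case 0
    then show ?case by (simp add: orbit_def)
  next
    case (Suc n)
    let ?f = "\<lambda>x. exp (lam * real_of_int x) * Z m (orbit T S x \<omega>)"
    have step: "measure_pmf.expectation (map_pmf (\<lambda>b. if b then x + 1 else x - 1)
        (bernoulli_pmf (pp (Tpow M T x \<omega>)))) ?f = exp (lam * real_of_int x) * Z (Suc m) (orbit T S x \<omega>)" for x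
      using orbit_space[OF \<omega>, of x] pp[of "orbit T S x \<omega>"] \<omega>
      by (simp add: S a b orbit_plus_1[OF \<omega>, of x, unfolded add.commute[of x 1]] orbit_minus_1
        exp_add exp_diff exp_minus field_simps)
    have "measure_pmf.expectation (?p (Suc n)) ?f =
        (\<Sum>x\<in>set_pmf (?p n). pmf (?p n) x *\<^sub>R (exp (lam * real_of_int x) * Z (Suc m) (orbit T S x \<omega>)))"
      unfolding walk_law.simps
      by (subst pmf_expectation_bind[OF fin[of n] _ order_refl]) (simp_all only: step, simp)
    also have "\<dots> = measure_pmf.expectation (?p n) (\<lambda>x. exp (lam * real_of_int x) * Z (Suc m) (orbit T S x \<omega>))"
      by (rule integral_measure_pmf[OF fin[of n], symmetric]) auto
    also have "\<dots> = Z (n + Suc m) \<omega>" by (rule Suc)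
    finally show ?case by simp
  qed
  from this[of 0] show ?thesis by (simp add: quenched_mgf_def)
qed

text \<open>\<open>\<Lambda>\<close> stays an extended real and is compared with real rates on
  either side. \<open>Z_upper\<close> and \<open>Z_lower_bound\<close> give the comparisons; their
  constants \<open>C\<close> vanish after division by \<open>n\<close>.\<close>

lemma free_energy:
  defines "\<Lambda> \<equiv> INF F\<in>classK M T. esssup M (\<lambda>\<omega>. ereal (ln (a \<omega> * exp (fst F \<omega>) + b \<omega> * exp (snd F \<omega>))))"
  shows "AE \<omega> in M. (\<lambda>n. ereal (ln (Z n \<omega>) / real n)) \<longlonglongrightarrow> \<Lambda>"
proof -
  have linear: "\<forall>\<^sub>F n in sequentially. d * real n + C < c * real n \<and> 0 < n" if "d < c" for c d C :: real
  proof -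
    have "\<forall>\<^sub>F n in sequentially. C / (c - d) < real n"
      using filterlim_real_sequentially by (simp add: filterlim_at_top_dense)
    then show ?thesis
      using eventually_gt_at_top[of 0] by eventually_elim (use that in \<open>simp add: field_simps\<close>)
  qed
  have ln_le_iff: "ln x \<le> y \<longleftrightarrow> x \<le> exp y" if "0 < x" for x y :: real
    using ln_le_cancel_iff[of x "exp y"] that by simp
  have upper: "AE \<omega> in M. \<forall>\<^sub>F n in sequentially. ereal (ln (Z n \<omega>) / real n) < ereal c"
    if c: "\<Lambda> < ereal c" for c
  proof -
    from c obtain Fp Fm where K: "(Fp, Fm) \<in> classK M T"
      and less: "esssup M (\<lambda>\<omega>. ereal (ln (a \<omega> * exp (Fp \<omega>) + b \<omega> * exp (Fm \<omega>)))) < ereal c"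
      by (auto simp: \<Lambda>_def INF_less_iff)
    obtain d where d: "esssup M (\<lambda>\<omega>. ereal (ln (a \<omega> * exp (Fp \<omega>) + b \<omega> * exp (Fm \<omega>)))) < ereal d" "d < c"
      using ereal_dense2[OF less] by auto
    have "AE \<omega> in M. a \<omega> * exp (Fp \<omega>) + b \<omega> * exp (Fm \<omega>) \<le> exp d"
      using esssup_AE[of "\<lambda>\<omega>. ereal (ln (a \<omega> * exp (Fp \<omega>) + b \<omega> * exp (Fm \<omega>)))" M] pos
    proof eventually_elim
      case (elim \<omega>)
      then have "0 < a \<omega> * exp (Fp \<omega>) + b \<omega> * exp (Fm \<omega>)"
        by (simp add: add_pos_pos)
      moreover have "ereal (ln (a \<omega> * exp (Fp \<omega>) + b \<omega> * exp (Fm \<omega>))) < ereal d"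
        using elim(1) d(1) by (rule le_less_trans)
      ultimately show ?case
        by (simp add: ln_le_iff[symmetric])
    qed
    from Z_upper[OF K this, of "(c - d) / 2"] d(2)
    have "AE \<omega> in M. \<exists>C. \<forall>n. Z n \<omega> \<le> exp ((d + (c - d) / 2) * real n + C)" by simp
    then show ?thesis
      using AE_space
    proof eventually_elim
      case (elim \<omega>)
      then obtain C where C: "\<And>n. Z n \<omega> \<le> exp ((d + (c - d) / 2) * real n + C)" by blast
      have "d + (c - d) / 2 < c" using d(2) by (simp add: field_simps)
      from linear[OF this, of C] show ?case
      proof eventually_elim
        case (elim n)
        have "ln (Z n \<omega>) \<le> (d + (c - d) / 2) * real n + C"
          using C[of n] Z_pos[OF \<open>\<omega> \<in> space M\<close>, of n] by (simp add: ln_le_iff)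
        then show ?case using elim by (simp add: pos_divide_less_eq)
      qed
    qed
  qed
  have lower: "AE \<omega> in M. \<forall>\<^sub>F n in sequentially. ereal c < ereal (ln (Z n \<omega>) / real n)"
    if c: "ereal c < \<Lambda>" for c
  proof -
    obtain d where d: "c < d" "ereal d < \<Lambda>" using ereal_dense2[OF c] by auto
    have "AE \<omega> in M. \<exists>C. \<forall>n. exp ((c + d) / 2 * real n - C) \<le> Z n \<omega>"
    proof (rule Z_lower_bound)
      fix Fp Fm assume K: "(Fp, Fm) \<in> classK M T"
      show "\<not> (AE \<omega> in M. a \<omega> * exp (Fp \<omega>) + b \<omega> * exp (Fm \<omega>) \<le> exp d)"
      proof
        assume le: "AE \<omega> in M. a \<omega> * exp (Fp \<omega>) + b \<omega> * exp (Fm \<omega>) \<le> exp d"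
        have [measurable]: "Fp \<in> borel_measurable M" "Fm \<in> borel_measurable M"
          using K by (auto simp: classK_def)
        have "esssup M (\<lambda>\<omega>. ereal (ln (a \<omega> * exp (Fp \<omega>) + b \<omega> * exp (Fm \<omega>)))) \<le> ereal d"
        proof (rule esssup_I)
          show "AE \<omega> in M. ereal (ln (a \<omega> * exp (Fp \<omega>) + b \<omega> * exp (Fm \<omega>))) \<le> ereal d"
            using le pos
          proof eventually_elim
            case (elim \<omega>)
            then have "0 < a \<omega> * exp (Fp \<omega>) + b \<omega> * exp (Fm \<omega>)"
              by (simp add: add_pos_pos)
            then show ?case using elim(1) by (simp add: ln_le_iff)
          qed
        qed measurable
        then have "\<Lambda> \<le> ereal d"
          unfolding \<Lambda>_def by (intro INF_lower2[OF K]) simp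
        with d(2) show False by simp
      qed
    qed (use d in \<open>simp add: field_simps\<close>)
    then show ?thesis
      using AE_space
    proof eventually_elim
      case (elim \<omega>)
      then obtain C where C: "\<And>n. exp ((c + d) / 2 * real n - C) \<le> Z n \<omega>" by blast
      have "c < (c + d) / 2" using d(1) by (simp add: field_simps)
      from linear[OF this, of C] show ?case
      proof eventually_elim
        case (elim n)
        have "(c + d) / 2 * real n - C \<le> ln (Z n \<omega>)"
          using C[of n] Z_pos[OF \<open>\<omega> \<in> space M\<close>, of n] by (simp add: ln_ge_iff)
        then show ?case using elim by (simp add: pos_less_divide_eq)
      qed
    qed
  qed
  \<comment> \<open>The exceptional null set depends on the rate; rational rates leave only
    countably many.\<close>
  have "AE \<omega> in M. \<forall>q::rat. \<Lambda> < ereal (real_of_rat q) \<longrightarrow>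
      (\<forall>\<^sub>F n in sequentially. ereal (ln (Z n \<omega>) / real n) < ereal (real_of_rat q))"
    using upper by (simp add: AE_all_countable)
  moreover have "AE \<omega> in M. \<forall>q::rat. ereal (real_of_rat q) < \<Lambda> \<longrightarrow>
      (\<forall>\<^sub>F n in sequentially. ereal (real_of_rat q) < ereal (ln (Z n \<omega>) / real n))"
    using lower by (simp add: AE_all_countable)
  ultimately show ?thesis
  proof eventually_elim
    case (elim \<omega>)
    show ?case
    proof (rule order_tendstoI)
      fix y assume "y < \<Lambda>"
      then obtain q :: rat where q: "y < ereal (real_of_rat q)" "ereal (real_of_rat q) < \<Lambda>"
        using ereal_dense3 by blast
      have "\<forall>\<^sub>F n in sequentially. ereal (real_of_rat q) < ereal (ln (Z n \<omega>) / real n)"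
        using elim(2) q(2) by blast
      then show "\<forall>\<^sub>F n in sequentially. y < ereal (ln (Z n \<omega>) / real n)"
        by (rule eventually_mono) (rule less_trans[OF q(1)])
    next
      fix y assume "\<Lambda> < y"
      then obtain q :: rat where q: "\<Lambda> < ereal (real_of_rat q)" "ereal (real_of_rat q) < y"
        using ereal_dense3 by blast
      have "\<forall>\<^sub>F n in sequentially. ereal (ln (Z n \<omega>) / real n) < ereal (real_of_rat q)"
        using elim(1) q(1) by blast
      then show "\<forall>\<^sub>F n in sequentially. ereal (ln (Z n \<omega>) / real n) < y"
        by (rule eventually_mono) (erule less_trans[OF _ q(2)])
    qed
  qed
qed

end

section \<open>The random walk in random environment\<close>

text \<open>As \<open>ln 0 = 0\<close>, integrable logarithms do not exclude zeros of
  \<open>pp\<close> and \<open>pm\<close>; almost sure positivity is therefore stated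
  separately.\<close>

theorem theorem5p2:
  fixes M :: "'a measure" and T :: "'a \<Rightarrow> 'a" and pp pm :: "'a \<Rightarrow> real"
  assumes "prob_space M"
    and "invertible_mpt M T"
    and "ergodic M T"
    and "pp \<in> borel_measurable M" and "pm \<in> borel_measurable M"
    and "\<And>\<omega>. \<omega> \<in> space M \<Longrightarrow> 0 \<le> pp \<omega> \<and> pp \<omega> \<le> 1"
    and "\<And>\<omega>. \<omega> \<in> space M \<Longrightarrow> 0 \<le> pm \<omega> \<and> pm \<omega> \<le> 1"
    and "\<And>\<omega>. \<omega> \<in> space M \<Longrightarrow> pp \<omega> + pm \<omega> = 1"
    and "AE \<omega> in M. 0 < pp \<omega> \<and> 0 < pm \<omega>"
    and "integrable M (\<lambda>\<omega>. \<bar>ln (pp \<omega>)\<bar>)"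
    and "integrable M (\<lambda>\<omega>. \<bar>ln (pm \<omega>)\<bar>)"
  shows "\<forall>lam::real. AE \<omega> in M.
           ((\<lambda>n. ereal (ln (quenched_mgf M T pp \<omega> lam n) / real n))
              \<longlongrightarrow> Lambda M T pp pm lam) sequentially"
proof
  fix lam :: real
  define S where "S = inv_into (space M) T"
  define a where "a \<omega> = pp \<omega> * exp lam" for \<omega>
  define b where "b \<omega> = pm \<omega> * exp (- lam)" for \<omega>
  interpret prob_space M by fact
  note [measurable] = \<open>pp \<in> borel_measurable M\<close> \<open>pm \<in> borel_measurable M\<close>
  have T: "T \<in> M \<rightarrow>\<^sub>M M" "bij_betw T (space M) (space M)" "S \<in> M \<rightarrow>\<^sub>M M"
      "\<And>A. A \<in> sets M \<Longrightarrow> emeasure M (T -` A \<inter> space M) = emeasure M A"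
    using assms(2) by (auto simp: invertible_mpt_def S_def)
  have ln_tilt: "integrable M (\<lambda>\<omega>. ln (f \<omega> * exp k))"
    if [measurable]: "f \<in> borel_measurable M" and f: "integrable M (\<lambda>\<omega>. \<bar>ln (f \<omega>)\<bar>)" "AE \<omega> in M. 0 < f \<omega>"
    for f :: "'a \<Rightarrow> real" and k
  proof -
    have "integrable M (\<lambda>\<omega>. ln (f \<omega>) + k)"
      using f(1) by (simp add: integrable_abs_iff)
    then show ?thesis
    proof (rule integrable_cong_AE_imp)
      show "AE \<omega> in M. ln (f \<omega>) + k = ln (f \<omega> * exp k)"
        using f(2) by eventually_elim (simp add: ln_mult)
    qed measurable
  qed
  \<comment> \<open>The probabilities sum to 1 and both exponentials are at least
    \<open>exp (- \<bar>lam\<bar>)\<close>, which gives the constant.\<close>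
  interpret weighted_environment M T S a b "\<bar>lam\<bar>"
  proof unfold_locales
    show "integrable M (\<lambda>\<omega>. ln (a \<omega>))" "integrable M (\<lambda>\<omega>. ln (b \<omega>))"
      unfolding a_def b_def using assms(9-11) by (auto intro!: ln_tilt elim!: eventually_mono)
    show "AE \<omega> in M. 0 < a \<omega> \<and> 0 < b \<omega>"
      using assms(9) by eventually_elim (simp add: a_def b_def)
    fix \<omega> assume \<omega>: "\<omega> \<in> space M"
    show "T (S \<omega>) = \<omega>" "S (T \<omega>) = \<omega>"
      using T(2) \<omega> by (auto simp: S_def bij_betw_def inv_into_f_f f_inv_into_f)
    show "0 \<le> a \<omega> \<and> 0 \<le> b \<omega>" using assms(6,7)[OF \<omega>] by (simp add: a_def b_def)
    have "exp (- \<bar>lam\<bar>) = pp \<omega> * exp (- \<bar>lam\<bar>) + pm \<omega> * exp (- \<bar>lam\<bar>)"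
      using assms(8)[OF \<omega>] by (simp add: distrib_right[symmetric])
    also have "\<dots> \<le> a \<omega> + b \<omega>"
      unfolding a_def b_def using assms(6,7)[OF \<omega>] by (intro add_mono mult_left_mono) auto
    finally show "exp (- \<bar>lam\<bar>) \<le> a \<omega> + b \<omega>" .
  next
    show "a \<in> borel_measurable M" "b \<in> borel_measurable M"
      unfolding a_def[abs_def] b_def[abs_def] by measurable
  qed (use T assms(3) in auto)
  have mgf: "quenched_mgf M T pp \<omega> lam n = Z n \<omega>" if "\<omega> \<in> space M" for \<omega> n
  proof (rule quenched_mgf_eq[OF _ assms(6) _ _ that])
    show "Tpow M T x \<eta> = orbit T S x \<eta>" for x \<eta>
      by (simp add: Tpow_def orbit_def S_def)
    show "b \<eta> = (1 - pp \<eta>) * exp (- lam)" if "\<eta> \<in> space M" for \<eta>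
    proof -
      have "pm \<eta> = 1 - pp \<eta>" using assms(8)[OF that] by linarith
      then show ?thesis by (simp only: b_def)
    qed
  qed (simp_all add: a_def)
  have \<Lambda>: "Lambda M T pp pm lam =
      (INF F\<in>classK M T. esssup M (\<lambda>\<omega>. ereal (ln (a \<omega> * exp (fst F \<omega>) + b \<omega> * exp (snd F \<omega>)))))"
    by (simp only: Lambda_def a_def b_def exp_add mult.assoc)
  show "AE \<omega> in M. ((\<lambda>n. ereal (ln (quenched_mgf M T pp \<omega> lam n) / real n))
      \<longlongrightarrow> Lambda M T pp pm lam) sequentially"
    using free_energy AE_space
  proof eventually_elim
    case (elim \<omega>)
    then show ?case by (simp only: \<Lambda> mgf)
  qed
qed

end
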